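(* Let $Z=X\cup Y$ be a finite nonempty set of even integers, where $X$ is the set of non-negative elements of $Z$ and $Y$ is the set of negative elements of $Z$. Then $Z$ is the imbalance set of a tournament if and only if either $Z=\{0\}$, or both $X$ and $Y$ are nonempty and one of the following holds: (i) $0\in Z$; (ii) for some non-negative integers $r,s$ there exist (not necessarily distinct) $x_{1},\ldots,x_{2r+1}\in X$ and (not necessarily distinct) $-y_{1},\ldots,-y_{2s}\in Y$ with $\sum_{j=1}^{2r+1}x_{j}=\sum_{j=1}^{2s}y_{j}$; (iii) for some non-negative integers $r,s$ there exist (not necessarily distinct) $-y_{1},\ldots,-y_{2r+1}\in Y$ and (not necessarily distinct) $x_{1},\ldots,x_{2s}\in X$ with $\sum_{j=1}^{2r+1}y_{j}=\sum_{j=1}^{2s}x_{j}$.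
   Context: A tournament is an orientation of a complete simple graph. The imbalance of a vertex $v$ in a digraph is $d^{+}(v)-d^{-}(v)$ (outdegree minus indegree), and the imbalance set of a digraph is the set of imbalances of its vertices.
   Formalization: The condition X ≠ {0} is added beside "both X and Y nonempty": as written the claim fails for Z={0,-2}, where X={0}, Y={-2} and 0∈Z, yet imbalances sum to 0, so no tournament has this imbalance set. *)

theory Defs
  imports "Graph_Theory.Digraph" "Graph_Theory.Kuratowski"
begin

text \<open>
  As in \<^theory>\<open>Graph_Theory.Digraph\<close>, a simple graph is a symmetric digraph (predicate
  \<^const>\<open>graph\<close>: finite, no loops, no parallel arcs); \<^const>\<open>complete_digraph\<close> is the complete
  simple graph in this sense. An orientation keeps exactly one of the two directions of each edge.
\<close>

definition orientation :: "('a, 'b) pre_digraph \<Rightarrow> ('a, 'c) pre_digraph \<Rightarrow> bool" where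
  "orientation D H \<longleftrightarrow> digraph D \<and> verts D = verts H \<and> arcs_ends D \<subseteq> arcs_ends H \<and>
     (\<forall>u v. u \<rightarrow>\<^bsub>H\<^esub> v \<longrightarrow> (u \<rightarrow>\<^bsub>D\<^esub> v \<and> \<not> v \<rightarrow>\<^bsub>D\<^esub> u) \<or> (v \<rightarrow>\<^bsub>D\<^esub> u \<and> \<not> u \<rightarrow>\<^bsub>D\<^esub> v))"

definition tournament :: "('a, 'b) pre_digraph \<Rightarrow> bool" where
  "tournament D \<longleftrightarrow>
     (\<exists>n (H :: ('a, 'a \<times> 'a) pre_digraph). complete_digraph n H \<and> orientation D H)"

definition imbalance :: "('a, 'b) pre_digraph \<Rightarrow> 'a \<Rightarrow> int" where
  "imbalance D v = int (out_degree D v) - int (in_degree D v)"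

definition imbalance_set :: "('a, 'b) pre_digraph \<Rightarrow> int set" where
  "imbalance_set D = imbalance D ` verts D"

text \<open>
  Tournaments are finite, so natural numbers suffice as vertices and pairs of them as arcs.
\<close>

definition is_tournament_imbalance_set :: "int set \<Rightarrow> bool" where
  "is_tournament_imbalance_set Z \<longleftrightarrow>
     (\<exists>D :: (nat, nat \<times> nat) pre_digraph. tournament D \<and> imbalance_set D = Z)"

text \<open>
  Imbalances sum to zero. Hence a set whose only non-negative element is 0, but which has a
  negative element, is never an imbalance set, although it contains 0 and its sets of
  non-negative and of negative elements are both nonempty. The characterization of imbalance
  sets of tournaments must therefore exclude it explicitly.
\<close>

lemma (in fin_digraph) sum_imbalance: "(\<Sum>v\<in>verts G. imbalance G v) = 0"
proof -
  have "(\<Sum>v\<in>verts G. card {e\<in>arcs G. tail G e = v}) = (\<Sum>v\<in>verts G. card {e\<in>arcs G. head G e = v})"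
    using sum.group[of "arcs G" "verts G" "tail G" "\<lambda>_. 1::nat"]
      sum.group[of "arcs G" "verts G" "head G" "\<lambda>_. 1::nat"]
    by (simp add: image_subset_iff)
  then show ?thesis
    unfolding imbalance_def out_degree_def in_degree_def out_arcs_def in_arcs_def
    by (simp add: sum_subtractf flip: of_nat_sum)
qed

lemma not_imbalance_set_if_no_positive:
  assumes "{z\<in>Z. 0 \<le> z} = {0}" and "{z\<in>Z. z < 0} \<noteq> {}"
  shows "\<not> is_tournament_imbalance_set Z"
proof
  assume "is_tournament_imbalance_set Z"
  then obtain D :: "(nat, nat \<times> nat) pre_digraph" where
    "tournament D" and Z: "imbalance_set D = Z"
    by (auto simp: is_tournament_imbalance_set_def)
  then have "digraph D" by (auto simp: tournament_def orientation_def)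
  then interpret fin_digraph D by (simp add: digraph_def)
  have le: "imbalance D v \<le> 0" if "v \<in> verts D" for v
  proof -
    have "imbalance D v \<in> Z" using that Z by (auto simp: imbalance_set_def)
    then show ?thesis using assms(1) by (cases "0 \<le> imbalance D v") auto
  qed
  obtain v where v: "v \<in> verts D" "imbalance D v < 0"
    using assms(2) Z by (auto simp: imbalance_set_def)
  have "(\<Sum>v\<in>verts D. imbalance D v) < (\<Sum>v\<in>verts D. 0)"
    using le v by (intro sum_strict_mono_ex1) auto
  then show False using sum_imbalance by simp
qed

end

theory Submission
  imports Defs
begin

text \<open>
  For nonempty \<open>Z\<close> the theorem reduces to: \<open>Z\<close> is an imbalance set iff it is the set of entries of
  a list of odd length with sum 0. One direction lists the imbalances of all vertices, their number
  being odd because an imbalance has the parity of the order minus one.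

  Conversely, repeating the list an odd number of times makes its length \<open>n\<close> larger than \<open>2M\<close>,
  where \<open>M\<close> bounds the absolute values of the entries. Start with a regular tournament on \<open>n\<close>
  vertices and move the imbalances towards the entries of the list by reversing paths from vertices
  with a too large imbalance to vertices with a too small one, so that they remain bounded by \<open>M\<close>.
  Such paths always exist: if \<open>R\<close> has no outgoing arcs, the imbalances in \<open>R\<close> sum to \<open>-\<bar>R\<bar>(n-\<bar>R\<bar>)\<close>,
  hence \<open>n - \<bar>R\<bar> \<le> M\<close>, and symmetrically \<open>\<bar>R\<bar> \<le> M\<close>.

  A list of even length with sum 0 whose entries are exactly those of \<open>Z\<close> exists as soon as \<open>Z\<close>
  has a positive element \<open>a\<close> and a negative element \<open>b\<close>: balance \<open>-b\<close> copies of each \<open>z > 0\<close> with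
  \<open>z\<close> copies of \<open>b\<close>, and similarly for \<open>z < 0\<close>; all these multiplicities are even. The conditions
  (i), (ii), (iii) are what is needed to make the length odd.
\<close>

section \<open>Tournaments as relations\<close>

text \<open>A bare relation instead of a \<open>pre_digraph\<close>, so that reversing an arc is a
  plain set operation.\<close>

definition tournament_on :: "'a set \<Rightarrow> ('a \<times> 'a) set \<Rightarrow> bool" where
  "tournament_on V E \<longleftrightarrow> finite V \<and> E \<subseteq> V \<times> V \<and> asym E \<and> total_on V E"

lemma tournament_on_irrefl: "tournament_on V E \<Longrightarrow> (u, u) \<notin> E"
  by (auto simp: tournament_on_def dest: asymD)

text \<open>The skew-symmetric adjacency matrix of \<open>E\<close>; imbalances are its row
  sums.\<close>

definition arc_sign :: "('a \<times> 'a) set \<Rightarrow> 'a \<Rightarrow> 'a \<Rightarrow> int" where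
  "arc_sign E u v = of_bool ((u, v) \<in> E) - of_bool ((v, u) \<in> E)"

definition rel_imbalance :: "'a set \<Rightarrow> ('a \<times> 'a) set \<Rightarrow> 'a \<Rightarrow> int" where
  "rel_imbalance V E v = (\<Sum>u\<in>V. arc_sign E v u)"

lemma sum_antisymmetric_eq_0:
  fixes f :: "'a \<Rightarrow> 'a \<Rightarrow> int"
  assumes "\<And>u v. f u v = - f v u"
  shows "(\<Sum>u\<in>A. \<Sum>v\<in>A. f u v) = 0"
proof -
  have "(\<Sum>u\<in>A. \<Sum>v\<in>A. f u v) = (\<Sum>v\<in>A. \<Sum>u\<in>A. f u v)"
    by (rule sum.swap)
  also have "\<dots> = (\<Sum>v\<in>A. \<Sum>u\<in>A. - f v u)"
    by (intro sum.cong refl assms)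
  also have "\<dots> = - (\<Sum>v\<in>A. \<Sum>u\<in>A. f v u)"
    by (simp add: sum_negf)
  finally show ?thesis by simp
qed

lemma arc_sign_antisymmetric: "arc_sign E u v = - arc_sign E v u"
  by (simp add: arc_sign_def)

text \<open>Pairs inside \<open>R\<close> cancel by antisymmetry, so only the arcs between
  \<open>R\<close> and its complement count.\<close>

lemma sum_rel_imbalance_subset:
  assumes "finite V" "R \<subseteq> V"
  shows "(\<Sum>v\<in>R. rel_imbalance V E v) = (\<Sum>v\<in>R. \<Sum>u\<in>V - R. arc_sign E v u)"
proof -
  have "(\<Sum>v\<in>R. rel_imbalance V E v)
      = (\<Sum>v\<in>R. (\<Sum>u\<in>V - R. arc_sign E v u) + (\<Sum>u\<in>R. arc_sign E v u))"
    unfolding rel_imbalance_def using assms by (simp add: sum.subset_diff)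
  then show ?thesis
    using sum_antisymmetric_eq_0[of "arc_sign E" R, OF arc_sign_antisymmetric]
    by (simp add: sum.distrib)
qed

lemma sum_rel_imbalance: "finite V \<Longrightarrow> (\<Sum>v\<in>V. rel_imbalance V E v) = 0"
  by (simp add: sum_rel_imbalance_subset)

lemma even_rel_imbalance_iff:
  assumes "tournament_on V E" "v \<in> V"
  shows "even (rel_imbalance V E v) \<longleftrightarrow> odd (card V)"
proof -
  \<comment> \<open>Off the diagonal the sign is 1 or -1; the last summand corrects the diagonal
    entry to 0.\<close>
  have "arc_sign E v u = 2 * of_bool ((v, u) \<in> E) - 1 + (if u = v then 1 else 0)" if "u \<in> V" for u
    using assms that by (auto simp: tournament_on_def arc_sign_def total_on_def dest: asymD)
  then have "rel_imbalance V E v = (\<Sum>u\<in>V. 2 * of_bool ((v, u) \<in> E) - 1 + (if u = v then 1 else 0))"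
    by (simp add: rel_imbalance_def)
  also have "\<dots> = 2 * (\<Sum>u\<in>V. of_bool ((v, u) \<in> E)) - int (card V) + 1"
    using assms by (simp add: tournament_on_def sum.distrib sum_subtractf sum_distrib_left)
  finally show ?thesis by simp
qed

lemma tournament_on_reverse_arc:
  assumes "tournament_on V E" "(u, v) \<in> E"
  shows "tournament_on V (insert (v, u) (E - {(u, v)}))"
proof -
  have "asym (insert (v, u) (E - {(u, v)}))"
    using assms tournament_on_irrefl[OF assms(1)]
    by (intro asymI) (auto simp: tournament_on_def dest: asymD)
  then show ?thesis
    using assms by (auto simp: tournament_on_def total_on_def)
qed

lemma rel_imbalance_reverse_arc:
  assumes "tournament_on V E" "(u, v) \<in> E"
  shows "rel_imbalance V (insert (v, u) (E - {(u, v)})) x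
    = rel_imbalance V E x - 2 * of_bool (x = u) + 2 * of_bool (x = v)"
proof -
  have uv: "u \<in> V" "v \<in> V" "u \<noteq> v" "(v, u) \<notin> E"
    using assms by (auto simp: tournament_on_def dest: asymD)
  have "arc_sign (insert (v, u) (E - {(u, v)})) x y
      = arc_sign E x y - (if y = v then 2 * of_bool (x = u) else 0)
        + (if y = u then 2 * of_bool (x = v) else 0)" for y
    unfolding arc_sign_def using uv assms(2)
    by (cases "x = u"; cases "x = v"; cases "y = u"; cases "y = v") simp_all
  then show ?thesis
    using assms uv by (simp add: rel_imbalance_def sum.distrib sum_subtractf tournament_on_def)
qed

section \<open>Path reversal\<close>

text \<open>Each inner vertex trades one incoming and one outgoing arc for each other, so only the
  two ends change. For a one-vertex path the two corrections cancel.\<close>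

lemma reverse_path:
  assumes "tournament_on V E" "successively (\<lambda>x y. (x, y) \<in> E) p" "distinct p" "p \<noteq> []"
  shows "\<exists>E'. tournament_on V E' \<and> (\<forall>x. rel_imbalance V E' x
    = rel_imbalance V E x - 2 * of_bool (x = hd p) + 2 * of_bool (x = last p))"
  using assms
proof (induction p arbitrary: E)
  case (Cons u p)
  show ?case
  proof (cases p)
    case Nil
    then show ?thesis using Cons.prems(1) by auto
  next
    case (Cons v q)
    define E1 where "E1 = insert (v, u) (E - {(u, v)})"
    have uv: "(u, v) \<in> E" and p: "successively (\<lambda>x y. (x, y) \<in> E) p"
      using Cons.prems Cons by auto
    \<comment> \<open>The removed arc starts at \<open>u\<close>, which by distinctness does not
      occur in \<open>p\<close>.\<close>
    have "successively (\<lambda>x y. (x, y) \<in> E1) p"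
      using p by (rule successively_mono) (use Cons.prems(3) in \<open>auto simp: E1_def\<close>)
    moreover have "tournament_on V E1"
      using tournament_on_reverse_arc[OF Cons.prems(1) uv] by (simp add: E1_def)
    ultimately obtain E' where "tournament_on V E'"
      and "\<forall>x. rel_imbalance V E' x
        = rel_imbalance V E1 x - 2 * of_bool (x = hd p) + 2 * of_bool (x = last p)"
      using Cons.IH[of E1] Cons.prems(3) Cons by auto
    then show ?thesis
      using rel_imbalance_reverse_arc[OF Cons.prems(1) uv] Cons by (auto simp: E1_def)
  qed
qed simp

lemma rtrancl_imp_distinct_path:
  assumes "(u, w) \<in> E\<^sup>*"
  shows "\<exists>p. successively (\<lambda>x y. (x, y) \<in> E) p \<and> distinct p \<and> p \<noteq> [] \<and> hd p = u \<and> last p = w"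
  using assms
proof (induction rule: converse_rtrancl_induct)
  case base
  have "successively (\<lambda>x y. (x, y) \<in> E) [w]" by simp
  then show ?case by (intro exI[of _ "[w]"]) simp
next
  case (step u v)
  then obtain p where p: "successively (\<lambda>x y. (x, y) \<in> E) p" "distinct p" "p \<noteq> []"
    "hd p = v" "last p = w"
    by auto
  show ?case
  proof (cases "u \<in> set p")
    case True
    \<comment> \<open>If \<open>u\<close> is already on the path, the part before it is dropped
      instead of closing a cycle.\<close>
    then obtain q r where "p = q @ u # r" by (auto dest: split_list)
    then show ?thesis
      using p by (intro exI[of _ "u # r"]) (auto simp: successively_append_iff)
  next
    case False
    then show ?thesis
      using p step(1) by (intro exI[of _ "u # p"]) (auto simp: successively_Cons)
  qed
qed

lemma bounded_imbalance_imp_reachable: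
  assumes T: "tournament_on V E" and M: "\<And>v. v \<in> V \<Longrightarrow> \<bar>rel_imbalance V E v\<bar> \<le> int M"
    and n: "2 * M < card V" and u: "u \<in> V" and w: "w \<in> V"
  shows "(u, w) \<in> E\<^sup>*"
proof (rule ccontr)
  assume nreach: "(u, w) \<notin> E\<^sup>*"
  define R where "R = {v \<in> V. (u, v) \<in> E\<^sup>*}"
  have fin: "finite V" using T by (simp add: tournament_on_def)
  have R: "R \<subseteq> V" "finite R" "finite (V - R)" "u \<in> R" "w \<in> V - R"
    using fin u w nreach by (auto simp: R_def)
  \<comment> \<open>\<open>R\<close> is closed under successors, so every arc between
    \<open>R\<close> and its complement points into \<open>R\<close>.\<close>
  have sign: "arc_sign E x y = -1" if "x \<in> R" "y \<in> V - R" for x y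
  proof -
    have "(x, y) \<notin> E"
      using that by (auto simp: R_def dest: rtrancl_into_rtrancl)
    moreover have "x \<in> V" "y \<in> V" "x \<noteq> y" using that R(1) by auto
    ultimately show ?thesis using T by (auto simp: tournament_on_def arc_sign_def total_on_def)
  qed
  have sumR: "(\<Sum>v\<in>R. rel_imbalance V E v) = - (int (card R) * int (card (V - R)))"
    using sign by (simp add: sum_rel_imbalance_subset[OF fin R(1)])
  have "(\<Sum>v\<in>V. rel_imbalance V E v)
      = (\<Sum>v\<in>V - R. rel_imbalance V E v) + (\<Sum>v\<in>R. rel_imbalance V E v)"
    by (rule sum.subset_diff[OF R(1) fin])
  then have sumC: "(\<Sum>v\<in>V - R. rel_imbalance V E v) = int (card R) * int (card (V - R))"
    using sumR sum_rel_imbalance[OF fin, of E] by simp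
  have "(\<Sum>v\<in>R. - int M) \<le> (\<Sum>v\<in>R. rel_imbalance V E v)"
    using M R(1) by (intro sum_mono) (fastforce simp: abs_le_iff)
  then have "int (card R) * int (card (V - R)) \<le> int (card R) * int M"
    using sumR by simp
  then have C: "card (V - R) \<le> M"
    using R by (auto simp: mult_le_cancel_left card_gt_0_iff)
  have "(\<Sum>v\<in>V - R. rel_imbalance V E v) \<le> (\<Sum>v\<in>V - R. int M)"
    using M by (intro sum_mono) (auto simp: abs_le_iff)
  then have "int (card R) * int (card (V - R)) \<le> int M * int (card (V - R))"
    using sumC by (simp add: mult.commute)
  moreover have "0 < card (V - R)"
    using R by (auto simp: card_gt_0_iff)
  ultimately have "card R \<le> M"
    by (auto simp: mult_le_cancel_right)
  with C n card_Diff_subset[OF R(2,1)] show False by linarith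
qed

text \<open>Induction on the total deviation from \<open>t\<close>. The bound \<open>M\<close> on
  the imbalances is kept as an invariant, since it is what guarantees a path for the next
  reversal.\<close>

lemma ex_tournament_with_imbalances:
  assumes T: "tournament_on V E" and odd: "odd (card V)" and n: "2 * M < card V"
    and M: "\<And>v. v \<in> V \<Longrightarrow> \<bar>rel_imbalance V E v\<bar> \<le> int M"
    and t: "\<And>v. v \<in> V \<Longrightarrow> even (t v) \<and> \<bar>t v\<bar> \<le> int M" "(\<Sum>v\<in>V. t v) = 0"
  shows "\<exists>E'. tournament_on V E' \<and> (\<forall>v\<in>V. rel_imbalance V E' v = t v)"
  using T M
proof (induction "\<Sum>v\<in>V. nat \<bar>rel_imbalance V E v - t v\<bar>" arbitrary: E rule: less_induct)
  case less
  let ?b = "rel_imbalance V E"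
  have fin: "finite V" using less.prems(1) by (simp add: tournament_on_def)
  have sum0: "(\<Sum>v\<in>V. ?b v - t v) = 0"
    using sum_rel_imbalance[OF fin] t(2) by (simp add: sum_subtractf)
  show ?case
  proof (cases "\<forall>v\<in>V. ?b v = t v")
    case True
    then show ?thesis using less.prems(1) by auto
  next
    case False
    \<comment> \<open>The deviations sum to 0 without all being 0, so both signs occur.\<close>
    have "\<exists>u\<in>V. t u < ?b u"
    proof (rule ccontr)
      assume *: "\<not> (\<exists>u\<in>V. t u < ?b u)"
      then have "(\<Sum>v\<in>V. ?b v - t v) < (\<Sum>v\<in>V. 0)"
        using False by (intro sum_strict_mono_ex1[OF fin]) force+
      then show False using sum0 by simp
    qed
    then obtain u where u: "u \<in> V" "t u < ?b u" by auto
    have "\<exists>w\<in>V. ?b w < t w"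
    proof (rule ccontr)
      assume *: "\<not> (\<exists>w\<in>V. ?b w < t w)"
      then have "(\<Sum>v\<in>V. 0) < (\<Sum>v\<in>V. ?b v - t v)"
        using False by (intro sum_strict_mono_ex1[OF fin]) force+
      then show False using sum0 by simp
    qed
    then obtain w where w: "w \<in> V" "?b w < t w" by auto
    have parity: "even (?b v)" if "v \<in> V" for v
      using even_rel_imbalance_iff[OF less.prems(1) that] odd by simp
    \<comment> \<open>Both sides are even, so a strict gap is at least 2. A reversal shifts the end
      imbalances by 2 and hence cannot overshoot.\<close>
    have u2: "t u + 2 \<le> ?b u"
      using u(2) parity[OF u(1)] conjunct1[OF t(1)[OF u(1)]] by presburger
    have w2: "?b w + 2 \<le> t w"
      using w(2) parity[OF w(1)] conjunct1[OF t(1)[OF w(1)]] by presburger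
    obtain E' where E': "tournament_on V E'"
      and b': "\<And>x. rel_imbalance V E' x = ?b x - 2 * of_bool (x = u) + 2 * of_bool (x = w)"
      using rtrancl_imp_distinct_path[OF bounded_imbalance_imp_reachable
          [OF less.prems(1) less.prems(2) n u(1) w(1)]] reverse_path[OF less.prems(1)]
      by metis
    have le: "\<bar>rel_imbalance V E' v - t v\<bar> \<le> \<bar>?b v - t v\<bar>" for v
      using u2 w2 by (auto simp: b')
    have "(\<Sum>v\<in>V. nat \<bar>rel_imbalance V E' v - t v\<bar>) < (\<Sum>v\<in>V. nat \<bar>?b v - t v\<bar>)"
    proof (rule sum_strict_mono_ex1[OF fin])
      show "\<forall>v\<in>V. nat \<bar>rel_imbalance V E' v - t v\<bar> \<le> nat \<bar>?b v - t v\<bar>"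
        using le by (auto intro: nat_mono)
      show "\<exists>v\<in>V. nat \<bar>rel_imbalance V E' v - t v\<bar> < nat \<bar>?b v - t v\<bar>"
        using u u2 w by (intro bexI[of _ u]) (auto simp: b')
    qed
    \<comment> \<open>Each new imbalance lies between the old one and its target, both bounded by
      \<open>M\<close>.\<close>
    moreover have "\<bar>rel_imbalance V E' v\<bar> \<le> int M" if "v \<in> V" for v
      using less.prems(2)[OF that] t(1)[OF that] u2 w2 by (auto simp: b')
    ultimately show ?thesis using less.hyps[of E'] E' by blast
  qed
qed

section \<open>Realizing a list of imbalances\<close>

lemma sum_alternating: "(\<Sum>j<m. (- 1) ^ j) = (of_bool (odd m) :: int)"
  by (induction m) auto

text \<open>
  For \<open>i < j\<close> the arc between \<open>i\<close> and \<open>j\<close> is directed upwards iff \<open>j - i\<close> is odd, so that its sign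
  alternates with \<open>j\<close>.
\<close>

lemma ex_regular_tournament:
  fixes n :: nat
  assumes "odd n"
  shows "\<exists>E. tournament_on {..<n} E \<and> (\<forall>i<n. rel_imbalance {..<n} E i = 0)"
proof (intro exI conjI allI impI)
  define E where "E = {(i, j). i < n \<and> j < n \<and> (i < j \<and> odd (i + j) \<or> j < i \<and> even (i + j))}"
  show "tournament_on {..<n} E"
    by (auto simp: tournament_on_def E_def total_on_def intro!: asymI)
  fix i assume i: "i < n"
  have split: "{..<n} = {..<i} \<union> {i} \<union> {Suc i..<n}" "{..<n} = {..<Suc i} \<union> {Suc i..<n}"
    using i by auto
  have disj: "{..<i} \<inter> {Suc i..<n} = {}" "{..<Suc i} \<inter> {Suc i..<n} = {}"
    by auto
  have "rel_imbalance {..<n} E i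
      = (\<Sum>j<i. arc_sign E i j) + (arc_sign E i i + (\<Sum>j\<in>{Suc i..<n}. arc_sign E i j))"
    unfolding rel_imbalance_def
    by (subst split(1)) (simp add: sum.union_disjoint[OF _ _ disj(1)])
  \<comment> \<open>The sign is \<open>(- 1) ^ (i + j)\<close> for \<open>j < i\<close> and its
    negative for \<open>j > i\<close>.\<close>
  also have "(\<Sum>j<i. arc_sign E i j) = (\<Sum>j<i. (- 1) ^ i * (- 1) ^ j)"
    using i by (intro sum.cong) (auto simp: arc_sign_def E_def)
  also have "\<dots> = (- 1) ^ i * of_bool (odd i)"
    by (simp add: sum_distrib_left[symmetric] sum_alternating)
  also have "(\<Sum>j\<in>{Suc i..<n}. arc_sign E i j) = (\<Sum>j\<in>{Suc i..<n}. - ((- 1) ^ i * (- 1) ^ j))"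
    using i by (intro sum.cong) (auto simp: arc_sign_def E_def)
  also have "\<dots> = - ((- 1) ^ i * (\<Sum>j\<in>{Suc i..<n}. (- 1) ^ j))"
    by (simp add: sum_negf sum_distrib_left)
  also have "(\<Sum>j\<in>{Suc i..<n}. (- 1) ^ j) = (\<Sum>j<n. (- 1) ^ j) - (\<Sum>j<Suc i. (- 1) ^ j :: int)"
    by (subst split(2)) (simp add: sum.union_disjoint[OF _ _ disj(2)] del: sum.lessThan_Suc)
  \<comment> \<open>As \<open>n\<close> is odd, the full alternating sum is 1, leaving
    \<open>1 - of_bool (even i)\<close>; the contributions from below and above \<open>i\<close>
    then cancel.\<close>
  also have "\<dots> = of_bool (odd i)"
    unfolding sum_alternating using assms by simp
  also have "arc_sign E i i = 0"
    by (simp add: arc_sign_def)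
  finally show "rel_imbalance {..<n} E i = 0" by simp
qed

section \<open>Translation between digraphs and relations\<close>

lemma imbalance_eq_rel_imbalance:
  fixes D :: "('a, 'b) pre_digraph"
  assumes "digraph D"
  shows "imbalance D v = rel_imbalance (verts D) (arcs_ends D) v"
proof -
  interpret digraph D by fact
  \<comment> \<open>Without parallel arcs, an arc at \<open>v\<close> is determined by its other
    end, so degrees count neighbours.\<close>
  have 1: "inj_on (head D) (out_arcs D v)" "inj_on (tail D) (in_arcs D v)"
    using no_multi_arcs by (auto simp: inj_on_def arc_to_ends_def)
  have 2: "head D ` out_arcs D v = {u \<in> verts D. (v, u) \<in> arcs_ends D}"
    "tail D ` in_arcs D v = {u \<in> verts D. (u, v) \<in> arcs_ends D}"
    by (force simp: arcs_ends_conv image_iff)+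
  have "out_degree D v = card {u \<in> verts D. (v, u) \<in> arcs_ends D}"
    "in_degree D v = card {u \<in> verts D. (u, v) \<in> arcs_ends D}"
    unfolding out_degree_def in_degree_def using card_image[OF 1(1)] card_image[OF 1(2)] 2
    by simp_all
  then show ?thesis
    by (simp add: imbalance_def rel_imbalance_def arc_sign_def sum_subtractf of_bool_def
        sum.If_cases Int_def conj_commute)
qed

lemma tournament_imp_tournament_on:
  assumes "tournament D"
  shows "digraph D \<and> tournament_on (verts D) (arcs_ends D)"
proof -
  obtain n and H :: "('a, 'a \<times> 'a) pre_digraph" where
    H: "complete_digraph n H" "orientation D H"
    using assms by (auto simp: tournament_def)
  then have D: "digraph D" by (simp add: orientation_def)
  then interpret digraph D .
  have sub: "arcs_ends D \<subseteq> verts D \<times> verts D"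
    by (auto simp: arcs_ends_conv)
  have H_iff: "(u, v) \<in> arcs_ends H \<longleftrightarrow> u \<in> verts D \<and> v \<in> verts D \<and> u \<noteq> v" for u v
    using H by (auto simp: complete_digraph_def orientation_def)
  have "asym (arcs_ends D)"
  proof (rule asymI)
    fix u v assume "(u, v) \<in> arcs_ends D"
    moreover from this have "(u, v) \<in> arcs_ends H"
      using H(2) by (auto simp: orientation_def)
    ultimately show "(v, u) \<notin> arcs_ends D"
      using H(2) by (auto simp: orientation_def)
  qed
  moreover have "total_on (verts D) (arcs_ends D)"
    using H(2) H_iff unfolding total_on_def orientation_def by blast
  ultimately show ?thesis using D sub by (simp add: tournament_on_def)
qed

definition rel_digraph :: "'a set \<Rightarrow> ('a \<times> 'a) set \<Rightarrow> ('a, 'a \<times> 'a) pre_digraph" where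
  "rel_digraph V E = \<lparr>verts = V, arcs = E, tail = fst, head = snd\<rparr>"

lemma verts_rel_digraph [simp]: "verts (rel_digraph V E) = V"
  by (simp add: rel_digraph_def)

lemma arcs_ends_rel_digraph [simp]: "arcs_ends (rel_digraph V E) = E"
  by (simp add: rel_digraph_def arcs_ends_conv)

lemma digraph_rel_digraph:
  assumes "finite V" "E \<subseteq> V \<times> V" "\<And>u. (u, u) \<notin> E"
  shows "digraph (rel_digraph V E)"
  using assms finite_subset[OF assms(2)]
  by unfold_locales (auto simp: rel_digraph_def arc_to_ends_def)

lemma tournament_rel_digraph:
  assumes T: "tournament_on V E"
  shows "tournament (rel_digraph V E)"
proof -
  have fin: "finite V" using T by (simp add: tournament_on_def)
  \<comment> \<open>The arcs of the complete graph that \<open>E\<close> orients.\<close>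
  define F where "F = {(u, v). (u, v) \<in> V \<times> V \<and> u \<noteq> v}"
  interpret F: digraph "rel_digraph V F"
    by (rule digraph_rel_digraph) (use fin in \<open>auto simp: F_def\<close>)
  have "symmetric (rel_digraph V F)"
    by (auto simp: symmetric_def F_def sym_def)
  then have "complete_digraph (card V) (rel_digraph V F)"
    using F.graphI by (auto simp: complete_digraph_def) (auto simp: F_def)
  moreover have "digraph (rel_digraph V E)"
    using T tournament_on_irrefl[OF T] by (intro digraph_rel_digraph) (auto simp: tournament_on_def)
  then have "orientation (rel_digraph V E) (rel_digraph V F)"
    using T by (auto simp: orientation_def tournament_on_def total_on_def F_def dest: asymD)
  ultimately show ?thesis by (auto simp: tournament_def)
qed

section \<open>Imbalance sets as zero-sum lists of odd length\<close>

lemma sum_list_concat_replicate: "sum_list (concat (replicate k L)) = int k * sum_list L"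
  by (induction k) (auto simp: algebra_simps)

lemma length_concat_replicate: "length (concat (replicate k L)) = k * length L"
  by (induction k) auto

lemma is_tournament_imbalance_set_iff:
  assumes "Z \<noteq> {}" and even: "\<forall>z\<in>Z. even z"
  shows "is_tournament_imbalance_set Z \<longleftrightarrow> (\<exists>L. set L = Z \<and> odd (length L) \<and> sum_list L = 0)"
proof
  assume "is_tournament_imbalance_set Z"
  then obtain D :: "(nat, nat \<times> nat) pre_digraph" where
    D: "tournament D" "imbalance_set D = Z"
    by (auto simp: is_tournament_imbalance_set_def)
  then have dig: "digraph D" and T: "tournament_on (verts D) (arcs_ends D)"
    by (auto dest: tournament_imp_tournament_on)
  let ?b = "rel_imbalance (verts D) (arcs_ends D)"
  have fin: "finite (verts D)" using T by (simp add: tournament_on_def)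
  have Z: "Z = ?b ` verts D"
    using D(2) by (simp add: imbalance_set_def imbalance_eq_rel_imbalance[OF dig])
  obtain v where v: "v \<in> verts D" using Z assms(1) by auto
  then have "even (?b v)" using Z even by auto
  then have "odd (card (verts D))" using even_rel_imbalance_iff[OF T v] by simp
  moreover have "sum_list (map ?b (sorted_list_of_set (verts D))) = 0"
    using sum_rel_imbalance[OF fin] fin
    by (simp add: sum_list_distinct_conv_sum_set)
  ultimately show "\<exists>L. set L = Z \<and> odd (length L) \<and> sum_list L = 0"
    using Z fin by (intro exI[of _ "map ?b (sorted_list_of_set (verts D))"]) simp
next
  assume "\<exists>L. set L = Z \<and> odd (length L) \<and> sum_list L = 0"
  then obtain L where L: "set L = Z" "odd (length L)" "sum_list L = 0" by auto
  define M where "M = nat (Max (abs ` Z))"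
  have fin: "finite Z" using L(1) by auto
  have M: "\<bar>z\<bar> \<le> int M" if "z \<in> Z" for z
  proof -
    have "\<bar>z\<bar> \<le> Max (abs ` Z)" using that fin by (intro Max_ge) auto
    then show ?thesis unfolding M_def by linarith
  qed
  \<comment> \<open>An odd number of copies preserves the odd length, the sum 0 and the bound
    \<open>M\<close>; since \<open>L\<close> is nonempty, this many copies exceed length
    \<open>2 * M\<close>.\<close>
  define K where "K = concat (replicate (2 * M + 1) L)"
  define n where "n = length K"
  have K: "set K = Z" "sum_list K = 0" "n = (2 * M + 1) * length L"
    using L by (auto simp: K_def n_def sum_list_concat_replicate length_concat_replicate
        simp del: replicate.simps)
  have "odd n" using L(2) unfolding K(3) by simp
  have "0 < length L" using L(2) by (cases L) auto
  then have n: "2 * M < n" unfolding K(3) by (cases "length L") auto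
  obtain E0 where E0: "tournament_on {..<n} E0" "\<forall>i<n. rel_imbalance {..<n} E0 i = 0"
    using ex_regular_tournament[OF \<open>odd n\<close>] by auto
  have "\<exists>E. tournament_on {..<n} E \<and> (\<forall>i\<in>{..<n}. rel_imbalance {..<n} E i = K ! i)"
  proof (rule ex_tournament_with_imbalances[OF E0(1), of M])
    show "even (K ! i) \<and> \<bar>K ! i\<bar> \<le> int M" if "i \<in> {..<n}" for i
    proof -
      have "K ! i \<in> Z" using that K(1) by (auto simp: n_def)
      then show ?thesis using even M by auto
    qed
    show "(\<Sum>i<n. K ! i) = 0"
      using K(2) by (simp add: sum_list_sum_nth n_def atLeast0LessThan)
  qed (use E0 \<open>odd n\<close> n in auto)
  then obtain E where E: "tournament_on {..<n} E"
    "\<And>i. i < n \<Longrightarrow> rel_imbalance {..<n} E i = K ! i"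
    by auto
  let ?D = "rel_digraph {..<n} E"
  have D: "tournament ?D" by (rule tournament_rel_digraph[OF E(1)])
  then have "digraph ?D" by (simp add: tournament_imp_tournament_on)
  then have "imbalance_set ?D = (!) K ` {..<n}"
    using E(2) by (simp add: imbalance_set_def imbalance_eq_rel_imbalance)
  also have "\<dots> = Z"
    using K(1) by (auto simp: n_def set_conv_nth)
  finally show "is_tournament_imbalance_set Z"
    using D by (auto simp: is_tournament_imbalance_set_def)
qed

section \<open>Lists of odd length with sum zero\<close>

text \<open>Naming the common sum \<open>c\<close> separates the two families, so that each can be
  turned into a list on its own.\<close>

lemma ex_common_value:
  "(\<exists>r s x y. P r x \<and> Q s y \<and> f r x = g s y) \<longleftrightarrow>
    (\<exists>r s c. (\<exists>x. P r x \<and> f r x = c) \<and> (\<exists>y. Q s y \<and> g s y = c))"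
  by metis

text \<open>The numbers \<open>r\<close> and \<open>s\<close> only express parities of lengths, so
  they can be eliminated.\<close>

lemma ex_odd_even_lists:
  "(\<exists>r s c. (\<exists>K. P K \<and> length K = 2 * r + 1 \<and> f K = c) \<and> (\<exists>L. Q L \<and> length L = 2 * s \<and> g L = c)) \<longleftrightarrow>
    (\<exists>K L. P K \<and> Q L \<and> odd (length K) \<and> even (length L) \<and> f K = g L)"
  (is "?lhs \<longleftrightarrow> ?rhs")
proof
  assume ?lhs
  then obtain r s c K L where "P K" "length K = 2 * r + 1" "f K = c" "Q L" "length L = 2 * s" "g L = c"
    by blast
  then show ?rhs by (intro exI[of _ K] exI[of _ L]) simp
next
  assume ?rhs
  then obtain K L where KL: "P K" "Q L" "odd (length K)" "even (length L)" "f K = g L"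
    by blast
  then obtain r s where "length K = 2 * r + 1" "length L = 2 * s"
    by (blast elim: oddE evenE)
  then show ?lhs
    using KL by (intro exI[of _ r] exI[of _ s] exI[of _ "f K"] conjI exI[of _ K] exI[of _ L]) simp_all
qed

lemma ex_sum_iff_ex_list:
  fixes A :: "int set"
  shows "(\<exists>x :: nat \<Rightarrow> int. (\<forall>j\<in>{1..n}. x j \<in> A) \<and> (\<Sum>j=1..n. x j) = c) \<longleftrightarrow>
    (\<exists>L. set L \<subseteq> A \<and> length L = n \<and> sum_list L = c)"
proof
  assume "\<exists>x :: nat \<Rightarrow> int. (\<forall>j\<in>{1..n}. x j \<in> A) \<and> (\<Sum>j=1..n. x j) = c"
  then obtain x :: "nat \<Rightarrow> int" where "\<forall>j\<in>{1..n}. x j \<in> A" "(\<Sum>j=1..n. x j) = c" by auto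
  then show "\<exists>L. set L \<subseteq> A \<and> length L = n \<and> sum_list L = c"
    by (intro exI[of _ "map x [1..<Suc n]"])
      (auto simp: sum_set_upt_conv_sum_list_nat[symmetric] atLeastLessThanSuc_atLeastAtMost
        simp del: upt_Suc)
next
  assume "\<exists>L. set L \<subseteq> A \<and> length L = n \<and> sum_list L = c"
  then obtain L where L: "set L \<subseteq> A" "length L = n" "sum_list L = c" by auto
  \<comment> \<open>Families are indexed from 1, lists from 0.\<close>
  have "(\<Sum>j=1..n. L ! (j - 1)) = (\<Sum>j<n. L ! j)"
    by (rule sum.reindex_bij_witness[of _ Suc "\<lambda>j. j - 1"]) auto
  also have "\<dots> = c"
    using L by (simp add: sum_list_sum_nth atLeast0LessThan)
  finally show "\<exists>x :: nat \<Rightarrow> int. (\<forall>j\<in>{1..n}. x j \<in> A) \<and> (\<Sum>j=1..n. x j) = c"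
    using L by (intro exI[of _ "\<lambda>j. L ! (j - 1)"]) (auto simp: subset_iff)
qed

lemma ex_sum_minus_iff_ex_list:
  fixes A :: "int set"
  shows "(\<exists>y :: nat \<Rightarrow> int. (\<forall>j\<in>{1..n}. - y j \<in> A) \<and> (\<Sum>j=1..n. y j) = c) \<longleftrightarrow>
    (\<exists>L. set L \<subseteq> A \<and> length L = n \<and> - sum_list L = c)"
proof -
  have "(\<exists>y :: nat \<Rightarrow> int. (\<forall>j\<in>{1..n}. - y j \<in> A) \<and> (\<Sum>j=1..n. y j) = c) \<longleftrightarrow>
      (\<exists>x :: nat \<Rightarrow> int. (\<forall>j\<in>{1..n}. x j \<in> A) \<and> (\<Sum>j=1..n. x j) = - c)"
    (is "(\<exists>y. ?P y) \<longleftrightarrow> (\<exists>x. ?Q x)")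
  proof
    assume "\<exists>y. ?P y"
    then obtain y where "?P y" ..
    then have "?Q (\<lambda>j. - y j)" by (simp add: sum_negf)
    then show "\<exists>x. ?Q x" by (rule exI[of _ "\<lambda>j. - y j"])
  next
    assume "\<exists>x. ?Q x"
    then obtain x where "?Q x" ..
    then have "?P (\<lambda>j. - x j)" by (simp add: sum_negf)
    then show "\<exists>y. ?P y" by (rule exI[of _ "\<lambda>j. - x j"])
  qed
  moreover have "sum_list L = - c \<longleftrightarrow> - sum_list L = c" for L by auto
  ultimately show ?thesis by (simp only: ex_sum_iff_ex_list)
qed

lemma ex_balanced_even_list:
  fixes Z :: "int set"
  assumes "finite Z" "\<forall>z\<in>Z. even z" "a \<in> Z" "0 < a" "b \<in> Z" "b < 0"
  shows "\<exists>L. set L = Z \<and> even (length L) \<and> sum_list L = 0"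
proof -
  \<comment> \<open>Only inclusions can be maintained for a subset \<open>A\<close>, because
    balancing its elements brings in \<open>a\<close> and \<open>b\<close>; for \<open>A = Z\<close>
    they give equality.\<close>
  have "\<exists>L. A \<subseteq> set L \<and> set L \<subseteq> Z \<and> even (length L) \<and> sum_list L = 0" if "A \<subseteq> Z" for A
    using finite_subset[OF that assms(1)] that
  proof (induction A rule: finite_induct)
    case empty
    show ?case by (intro exI[of _ "[]"]) simp
  next
    case (insert z A)
    then obtain L where L: "A \<subseteq> set L" "set L \<subseteq> Z" "even (length L)" "sum_list L = 0" by auto
    have z: "z \<in> Z" "even z" "even a" "even b" using insert.prems assms by auto
    \<comment> \<open>Each nonzero \<open>z\<close> is cancelled against an element of the opposite
      sign. The multiplicities are even because \<open>a\<close>, \<open>b\<close> and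
      \<open>z\<close> are; 0 is taken twice to keep the length even.\<close>
    define K where "K = (if z = 0 then [0, 0]
      else if 0 < z then replicate (nat (- b)) z @ replicate (nat z) b
      else replicate (nat a) z @ replicate (nat (- z)) a)"
    have "z \<in> set K" "set K \<subseteq> Z" "even (length K)" "sum_list K = 0"
      using z assms by (auto simp: K_def sum_list_replicate even_nat_iff)
    then show ?case
      using L by (intro exI[of _ "K @ L"]) auto
  qed
  from this[of Z] show ?thesis by auto
qed

text \<open>Entries of one weak sign with sum 0 are all 0; for the positive entry this is applied to
  the negated list.\<close>

lemma zero_sum_list_ex_pos_neg:
  fixes L :: "int list"
  assumes "sum_list L = 0" "L \<noteq> []" "set L \<noteq> {0}"
  shows "\<exists>a\<in>set L. 0 < a" "\<exists>b\<in>set L. b < 0"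
proof -
  have nz: "\<exists>z\<in>set L. z \<noteq> 0" using assms(2,3) by (cases L) auto
  have sum: "sum_list (map uminus L) = 0" using assms(1) by (simp add: uminus_sum_list_map[of id, simplified, symmetric])
  show "\<exists>a\<in>set L. 0 < a"
    using nz sum sum_list_nonneg_eq_0_iff[of "map uminus L"] by (force simp: not_less)
  show "\<exists>b\<in>set L. b < 0"
    using nz assms(1) sum_list_nonneg_eq_0_iff[of L] by (force simp: not_less)
qed

lemma sum_list_partition:
  fixes L :: "int list"
  shows "sum_list (filter P L) + sum_list (filter (\<lambda>x. \<not> P x) L) = sum_list L"
  by (induction L) auto

theorem theorem3p7:
  fixes Z X Y :: "int set"
  assumes "finite Z" and "Z \<noteq> {}" and "\<forall>z\<in>Z. even z"
    and "Z = X \<union> Y"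
    and "X = {z\<in>Z. 0 \<le> z}" and "Y = {z\<in>Z. z < 0}"
  shows "is_tournament_imbalance_set Z \<longleftrightarrow>
    Z = {0} \<or>
    (X \<noteq> {} \<and> X \<noteq> {0} \<and> Y \<noteq> {} \<and>
      (0 \<in> Z \<or>
       (\<exists>(r::nat) (s::nat) (x :: nat \<Rightarrow> int) (y :: nat \<Rightarrow> int).
          (\<forall>j\<in>{1..2*r+1}. x j \<in> X) \<and> (\<forall>j\<in>{1..2*s}. - y j \<in> Y) \<and>
          (\<Sum>j=1..2*r+1. x j) = (\<Sum>j=1..2*s. y j)) \<or>
       (\<exists>(r::nat) (s::nat) (y :: nat \<Rightarrow> int) (x :: nat \<Rightarrow> int).
          (\<forall>j\<in>{1..2*r+1}. - y j \<in> Y) \<and> (\<forall>j\<in>{1..2*s}. x j \<in> X) \<and>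
          (\<Sum>j=1..2*r+1. y j) = (\<Sum>j=1..2*s. x j))))"
proof -
  have X: "X \<subseteq> Z" and Y: "Y \<subseteq> Z" using assms(5,6) by auto
  \<comment> \<open>Common form of both sum conditions: keeping the negative elements with their
    sign turns equality of sums into a zero sum, and swapping \<open>A\<close> and \<open>B\<close>
    exchanges the conditions.\<close>
  define odd_even where "odd_even A B \<longleftrightarrow>
    (\<exists>K L. set K \<subseteq> A \<and> set L \<subseteq> B \<and> odd (length K) \<and> even (length L) \<and> sum_list K + sum_list L = 0)"
    for A B :: "int set"
  have ii: "(\<exists>(r::nat) (s::nat) (x :: nat \<Rightarrow> int) (y :: nat \<Rightarrow> int).
      (\<forall>j\<in>{1..2*r+1}. x j \<in> X) \<and> (\<forall>j\<in>{1..2*s}. - y j \<in> Y) \<and>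
      (\<Sum>j=1..2*r+1. x j) = (\<Sum>j=1..2*s. y j)) \<longleftrightarrow> odd_even X Y" (is "?ii \<longleftrightarrow> _")
  proof -
    have "?ii \<longleftrightarrow> (\<exists>r s c. (\<exists>x :: nat \<Rightarrow> int. (\<forall>j\<in>{1..2*r+1}. x j \<in> X) \<and> (\<Sum>j=1..2*r+1. x j) = c) \<and>
        (\<exists>y :: nat \<Rightarrow> int. (\<forall>j\<in>{1..2*s}. - y j \<in> Y) \<and> (\<Sum>j=1..2*s. y j) = c))"
      by (rule ex_common_value)
    then show ?thesis
      unfolding ex_sum_iff_ex_list ex_sum_minus_iff_ex_list ex_odd_even_lists
      unfolding odd_even_def eq_neg_iff_add_eq_0 neg_eq_iff_add_eq_0 .
  qed
  have iii: "(\<exists>(r::nat) (s::nat) (y :: nat \<Rightarrow> int) (x :: nat \<Rightarrow> int).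
      (\<forall>j\<in>{1..2*r+1}. - y j \<in> Y) \<and> (\<forall>j\<in>{1..2*s}. x j \<in> X) \<and>
      (\<Sum>j=1..2*r+1. y j) = (\<Sum>j=1..2*s. x j)) \<longleftrightarrow> odd_even Y X" (is "?iii \<longleftrightarrow> _")
  proof -
    have "?iii \<longleftrightarrow> (\<exists>r s c. (\<exists>y :: nat \<Rightarrow> int. (\<forall>j\<in>{1..2*r+1}. - y j \<in> Y) \<and> (\<Sum>j=1..2*r+1. y j) = c) \<and>
        (\<exists>x :: nat \<Rightarrow> int. (\<forall>j\<in>{1..2*s}. x j \<in> X) \<and> (\<Sum>j=1..2*s. x j) = c))"
      by (rule ex_common_value)
    then show ?thesis
      unfolding ex_sum_iff_ex_list ex_sum_minus_iff_ex_list ex_odd_even_lists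
      unfolding odd_even_def eq_neg_iff_add_eq_0 neg_eq_iff_add_eq_0 .
  qed
  have "(\<exists>L. set L = Z \<and> odd (length L) \<and> sum_list L = 0) \<longleftrightarrow>
    Z = {0} \<or> (X \<noteq> {} \<and> X \<noteq> {0} \<and> Y \<noteq> {} \<and> (0 \<in> Z \<or> odd_even X Y \<or> odd_even Y X))"
    (is "?list \<longleftrightarrow> _ \<or> ?cond")
  proof (intro iffI disj_imp[THEN iffD2] impI)
    assume ?list and Z0: "Z \<noteq> {0}"
    then obtain L where L: "set L = Z" "odd (length L)" "sum_list L = 0" by auto
    obtain a b where "a \<in> Z" "0 < a" "b \<in> Z" "b < 0"
      using zero_sum_list_ex_pos_neg[of L] L Z0 assms(2) by auto
    then have "a \<in> X" "a \<noteq> 0" "b \<in> Y" using assms(5,6) by auto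
    then have "X \<noteq> {}" "X \<noteq> {0}" "Y \<noteq> {}" by auto
    moreover have "odd_even X Y \<or> odd_even Y X"
    \<comment> \<open>Splitting \<open>L\<close> by sign gives two lists with total sum 0; as
      \<open>L\<close> has odd length, exactly one of them has odd length.\<close>
    proof -
      let ?P = "filter (\<lambda>z. 0 \<le> z) L" and ?N = "filter (\<lambda>z. \<not> 0 \<le> z) L"
      have "set ?P \<subseteq> X" "set ?N \<subseteq> Y" using L(1) assms(5,6) by auto
      moreover have "sum_list ?P + sum_list ?N = 0"
        using sum_list_partition[of "\<lambda>z. 0 \<le> z" L] L(3) by simp
      then have "sum_list ?P + sum_list ?N = 0" "sum_list ?N + sum_list ?P = 0" by simp_all
      moreover have "odd (length ?P + length ?N)"
        using L(2) sum_length_filter_compl[of "\<lambda>z. 0 \<le> z" L] by metis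
      then have "odd (length ?P) \<and> even (length ?N) \<or> odd (length ?N) \<and> even (length ?P)"
        by (simp only: even_add) blast
      ultimately show ?thesis unfolding odd_even_def by blast
    qed
    ultimately show ?cond by simp
  next
    assume "Z = {0} \<or> ?cond"
    then show ?list
    proof
      assume "Z = {0}"
      then show ?thesis by (intro exI[of _ "[0]"]) simp
    next
      assume cond: ?cond
      \<comment> \<open>The positive element comes from \<open>X\<close> being neither empty nor
        \<open>{0}\<close>.\<close>
      then obtain a b where "a \<in> Z" "0 < a" "b \<in> Z" "b < 0"
        using assms(5,6) by force
      then obtain L where L: "set L = Z" "even (length L)" "sum_list L = 0"
        using ex_balanced_even_list[OF assms(1,3)] by blast
      \<comment> \<open>It remains to flip the parity of \<open>L\<close>: an odd zero-sum list over
        \<open>Z\<close>, covering any part of it, is prepended.\<close>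
      have "\<exists>K. set K \<subseteq> Z \<and> odd (length K) \<and> sum_list K = 0"
      proof -
        have "\<exists>K. set K \<subseteq> Z \<and> odd (length K) \<and> sum_list K = 0"
          if AB: "odd_even A B" "A \<subseteq> Z" "B \<subseteq> Z" for A B
        proof -
          obtain K K' where "set K \<subseteq> A" "set K' \<subseteq> B" "odd (length K)" "even (length K')"
            "sum_list K + sum_list K' = 0"
            using AB(1) by (auto simp: odd_even_def)
          then show ?thesis using AB(2,3) by (intro exI[of _ "K @ K'"]) auto
        qed
        moreover have "\<exists>K. set K \<subseteq> Z \<and> odd (length K) \<and> sum_list K = 0" if "0 \<in> Z"
          using that by (intro exI[of _ "[0]"]) simp
        ultimately show ?thesis using cond X Y by blast
      qed
      then obtain K where "set K \<subseteq> Z" "odd (length K)" "sum_list K = 0" by auto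
      then show ?thesis using L by (intro exI[of _ "K @ L"]) auto
    qed
  qed
  then show ?thesis
    unfolding ii iii is_tournament_imbalance_set_iff[OF assms(2,3)] .
qed

end
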